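(* There is a constant $c>0$ such that for all sufficiently large $n$ there exists a function $f:\{0,1\}^n\times\{0,1\}^n\times\{0,1\}^n\to\{0,1\}$ such that $f$ has a $1$-fooling set of size $2^n$, but none of its induced functions $f^1,f^2,f^3$ has a ($0$- or $1$-)fooling set of size larger than $cn$ (i.e., no induced function has a fooling set of size $\omega(n)$).
   Context: For a two-argument function $g$, a $b$-fooling set of size $t$ is a set of pairs $\{(x_i,y_i)\}_{i\in[t]}$ with $g(x_i,y_i)=b$ for all $i$ and, for all $i\neq j$, at least one of $g(x_i,y_j),g(x_j,y_i)$ equals $1-b$. For a $k$-argument $f:(\{0,1\}^n)^k\to\{0,1\}$, $x,z\in(\{0,1\}^n)^k$ and a partition $A,B$ of $[k]$, let $\sigma^{A,B}(x,z)$ be the tuple whose $i$-th entry is $x_i$ if $i\in A$ and $z_i$ if $i\in B$; a set $F\subseteq(\{0,1\}^n)^k$ is a $b$-fooling set for $f$ if $f(x)=b$ for all $x\in F$ and for all $x\neq z$ in $F$ there is a partition $A,B$ of $[k]$ with $f(\sigma^{A,B}(x,z))=1-b$. The induced functions of a $3$-argument $f$ are the two-argument functions $f^1(x,(y,z))=f^2(y,(x,z))=f^3(z,(x,y))=f(x,y,z)$. *)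

theory Defs
  imports Complex_Main
begin

definition bitstrings :: "nat \<Rightarrow> bool list set" where
  "bitstrings n = {x. length x = n}"

text \<open>
  A \<open>k\<close>-tuple over \<open>X\<close> is a list of length \<open>k\<close> with entries in \<open>X\<close>; its positions
  are numbered \<open>0, \<dots>, k - 1\<close>. Functions on such tuples are total HOL functions, but all
  definitions below look only at their values on the intended (finite) domain. The values
  \<open>1\<close> and \<open>0\<close> are \<^const>\<open>True\<close> and \<^const>\<open>False\<close>, so \<open>1 - b\<close> is \<open>\<not> b\<close>.
\<close>

definition tuples :: "nat \<Rightarrow> 'a set \<Rightarrow> 'a list set" where
  "tuples k X = {xs. length xs = k \<and> set xs \<subseteq> X}"

text \<open>
  A fooling set of a two-argument function \<open>g\<close> on \<open>X \<times> Y\<close>. An indexed family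
  of pairs \<open>(x\<^sub>i, y\<^sub>i)\<close> with the fooling property is automatically injective, since
  \<open>(x\<^sub>i, y\<^sub>i) = (x\<^sub>j, y\<^sub>j)\<close> gives \<open>g x\<^sub>i y\<^sub>j = g x\<^sub>j y\<^sub>i = b\<close>; so its size is
  the cardinality of the set of pairs.
\<close>

definition fooling_set ::
  "'a set \<Rightarrow> 'b set \<Rightarrow> bool \<Rightarrow> ('a \<Rightarrow> 'b \<Rightarrow> bool) \<Rightarrow> ('a \<times> 'b) set \<Rightarrow> bool" where
  "fooling_set X Y b g S \<longleftrightarrow>
     S \<subseteq> X \<times> Y \<and>
     (\<forall>(x, y) \<in> S. g x y = b) \<and>
     (\<forall>(x, y) \<in> S. \<forall>(x', y') \<in> S. (x, y) \<noteq> (x', y') \<longrightarrow>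
        g x y' = (\<not> b) \<or> g x' y = (\<not> b))"

text \<open>
  For a partition \<open>A, B\<close> of the positions, \<open>mix A B x z\<close> takes its entries from \<open>x\<close>
  on \<open>A\<close> and from \<open>z\<close> on \<open>B\<close>. Parts of a partition may be empty; such a
  partition returns \<open>x\<close> or \<open>z\<close> and can never witness the fooling property.
\<close>

definition mix :: "nat set \<Rightarrow> nat set \<Rightarrow> 'a list \<Rightarrow> 'a list \<Rightarrow> 'a list" where
  "mix A B x z =
     map (\<lambda>i. if i \<in> A then x ! i else if i \<in> B then z ! i else undefined) [0..<length x]"

definition multi_fooling_set ::
  "nat \<Rightarrow> 'a set \<Rightarrow> bool \<Rightarrow> ('a list \<Rightarrow> bool) \<Rightarrow> 'a list set \<Rightarrow> bool" where
  "multi_fooling_set k X b f F \<longleftrightarrow>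
     F \<subseteq> tuples k X \<and>
     (\<forall>x \<in> F. f x = b) \<and>
     (\<forall>x \<in> F. \<forall>z \<in> F. x \<noteq> z \<longrightarrow>
        (\<exists>A B. A \<union> B = {..<k} \<and> A \<inter> B = {} \<and> f (mix A B x z) = (\<not> b)))"

definition induced1 :: "('a list \<Rightarrow> bool) \<Rightarrow> 'a \<Rightarrow> 'a \<times> 'a \<Rightarrow> bool" where
  "induced1 f = (\<lambda>x (y, z). f [x, y, z])"

definition induced2 :: "('a list \<Rightarrow> bool) \<Rightarrow> 'a \<Rightarrow> 'a \<times> 'a \<Rightarrow> bool" where
  "induced2 f = (\<lambda>y (x, z). f [x, y, z])"

definition induced3 :: "('a list \<Rightarrow> bool) \<Rightarrow> 'a \<Rightarrow> 'a \<times> 'a \<Rightarrow> bool" where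
  "induced3 f = (\<lambda>z (x, y). f [x, y, z])"

end

theory Submission
  imports Defs
begin

text \<open>
  Take \<open>f(x,x,x) = 1\<close>. For \<open>a \<noteq> b\<close> draw one random bit \<open>r(a,b)\<close> and let
  \<open>f(a,a,b) = f(b,a,a) = r(a,b)\<close> and \<open>f(a,b,a) = 1 - r(a,b)\<close>; on triples of distinct strings
  let \<open>f\<close> be independent random bits. The diagonal is a \<open>1\<close>-fooling set, since one of
  \<open>f(a,a,b)\<close>, \<open>f(a,b,a)\<close> is \<open>0\<close>. The matrix of an induced function has independent fair
  entries outside the cells whose row string occurs in the column pair, at most two
  per column. A set of \<open>2s\<close> candidate pairs, split into two halves, therefore involves at least
  \<open>s(s - 4)\<close> disjoint pairs of independent cells, and each pair of cells satisfies the fooling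
  condition with probability \<open>3/4\<close>. For \<open>s = 24n\<close> the union bound over all candidates succeeds.
\<close>

section \<open>Counting sets that avoid one pattern on each of several disjoint pairs\<close>

text \<open>For \<open>R\<close> uniform in \<open>Pow T\<close> the traces on the disjoint pairs
  \<open>{p i, q i}\<close> are independent, and each condition rules out one of four equally likely
  traces. The induction removes one pair at a time from \<open>T\<close>.\<close>

lemma card_avoiding_le:
  fixes p q :: "'i \<Rightarrow> 'k"
  assumes "finite I" "finite T" "p ` I \<subseteq> T" "q ` I \<subseteq> T"
    and "inj_on p I" "inj_on q I" "p ` I \<inter> q ` I = {}"
  shows "real (card {R \<in> Pow T. \<forall>i\<in>I. \<not> ((p i \<in> R) = u i \<and> (q i \<in> R) = v i)})
    \<le> (3/4) ^ card I * 2 ^ card T"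
  using assms
proof (induction I arbitrary: T rule: finite_induct)
  case empty
  then show ?case using card_Pow[of T] by (simp add: Pow_def)
next
  case (insert i I)
  let ?avoid = "\<lambda>J U. {R \<in> Pow U. \<forall>j\<in>J. \<not> ((p j \<in> R) = u j \<and> (q j \<in> R) = v j)}"
  let ?P = "{p i, q i}"
  define U where "U = T - ?P"
  \<comment> \<open>This is the only trace of \<open>R\<close> on \<open>?P\<close> that the
    condition for \<open>i\<close> forbids, so three of the four subsets of \<open>?P\<close>
    survive.\<close>
  define c where "c = {x. x = p i \<and> u i \<or> x = q i \<and> v i}"
  have disj: "p j \<noteq> q k" if "j \<in> insert i I" "k \<in> insert i I" for j k
    using insert.prems(6) that by blast
  have inj: "p j \<noteq> p i" "q j \<noteq> q i" if "j \<in> I" for j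
    using insert.prems(4,5) insert.hyps(2) that unfolding inj_on_def by blast+
  have neq: "p i \<noteq> q i" by (rule disj) simp_all
  have PT: "?P \<subseteq> T" using insert.prems(2,3) by simp
  have cP: "c \<in> Pow ?P" by (auto simp: c_def)
  have sub: "p ` I \<subseteq> U" "q ` I \<subseteq> U"
  proof -
    have "p j \<in> U \<and> q j \<in> U" if j: "j \<in> I" for j
      using insert.prems(2,3) inj[OF j] disj[of j i] disj[of i j] j by (simp add: U_def image_subset_iff)
    then show "p ` I \<subseteq> U" "q ` I \<subseteq> U" by blast+
  qed
  have finU: "finite U" using insert.prems by (simp add: U_def)
  have cardT: "card T = card U + 2"
  proof -
    have "card ?P \<le> card T" using PT insert.prems(1) by (intro card_mono) auto
    then show ?thesis using PT insert.prems(1) neq by (simp add: U_def card_Diff_subset)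
  qed
  have IH: "real (card (?avoid I U)) \<le> (3/4) ^ card I * 2 ^ card U"
  proof (rule insert.IH[OF finU sub])
    show "inj_on p I" "inj_on q I" using insert.prems(4,5) by simp_all
    show "p ` I \<inter> q ` I = {}" using insert.prems(6) by blast
  qed
  have "card (?avoid (insert i I) T) \<le> card (?avoid I U \<times> (Pow ?P - {c}))"
  proof (rule card_inj_on_le[where f = "\<lambda>R. (R \<inter> U, R \<inter> ?P)"])
    show "inj_on (\<lambda>R. (R \<inter> U, R \<inter> ?P)) (?avoid (insert i I) T)"
    proof (rule inj_onI)
      fix R R' assume RR': "R \<in> ?avoid (insert i I) T" "R' \<in> ?avoid (insert i I) T"
        and eq: "(R \<inter> U, R \<inter> ?P) = (R' \<inter> U, R' \<inter> ?P)"
      have "R \<inter> U \<union> R \<inter> ?P = R' \<inter> U \<union> R' \<inter> ?P" using eq by simp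
      moreover have "A \<inter> U \<union> A \<inter> ?P = A" if "A \<subseteq> T" for A using that unfolding U_def by blast
      ultimately show "R = R'" using RR' by simp
    qed
    show "(\<lambda>R. (R \<inter> U, R \<inter> ?P)) ` ?avoid (insert i I) T \<subseteq> ?avoid I U \<times> (Pow ?P - {c})"
    proof (rule image_subsetI)
      fix R assume R: "R \<in> ?avoid (insert i I) T"
      have "R \<inter> ?P \<noteq> c"
      proof
        assume *: "R \<inter> ?P = c"
        have "(p i \<in> R) = (p i \<in> c)" "(q i \<in> R) = (q i \<in> c)" using * by blast+
        moreover have "(p i \<in> c) = u i" "(q i \<in> c) = v i" using neq by (auto simp: c_def)
        ultimately show False using R by blast
      qed
      moreover have "R \<inter> U \<in> ?avoid I U"
        using R sub by (auto simp: image_subset_iff)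
      ultimately show "(R \<inter> U, R \<inter> ?P) \<in> ?avoid I U \<times> (Pow ?P - {c})" by simp
    qed
    show "finite (?avoid I U \<times> (Pow ?P - {c}))" using finU by auto
  qed
  also have "\<dots> = 3 * card (?avoid I U)"
  proof -
    have "card (Pow ?P - {c}) = 3"
      using cP neq by (subst card_Diff_singleton) (simp_all add: card_Pow)
    then show ?thesis by (simp add: card_cartesian_product)
  qed
  finally have "real (card (?avoid (insert i I) T)) \<le> 3 * real (card (?avoid I U))" by linarith
  also have "\<dots> \<le> 3 * ((3/4) ^ card I * 2 ^ card U)" using IH by simp
  also have "\<dots> = (3/4) ^ card (insert i I) * 2 ^ card T"
    using insert.hyps by (simp add: cardT)
  finally show ?case .
qed

section \<open>The probability that a fixed candidate is a fooling set\<close>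

lemma card_relation_le:
  assumes "finite B" "\<And>b. b \<in> B \<Longrightarrow> card {a \<in> A. P a b} \<le> c" "card B \<le> s"
  shows "card {(a, b) \<in> A \<times> B. P a b} \<le> c * s"
proof -
  have "{(a, b) \<in> A \<times> B. P a b} = (\<Union>b\<in>B. {a \<in> A. P a b} \<times> {b})" by auto
  also have "card \<dots> \<le> (\<Sum>b\<in>B. card ({a \<in> A. P a b} \<times> {b}))"
    using assms(1) by (rule card_UN_le)
  also have "\<dots> \<le> (\<Sum>b\<in>B. c)"
    by (intro sum_mono) (simp add: card_cartesian_product assms)
  also have "\<dots> \<le> c * s" using assms(3) by simp
  finally show ?thesis .
qed

text \<open>If two pairs share a row or a column, both crossed values are values at the pairs
  themselves, hence equal to \<open>b\<close>, and the pairs must coincide.\<close>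

lemma fooling_set_inj_on:
  assumes "fooling_set X Y b g S"
  shows "inj_on fst S" "inj_on snd S"
proof -
  have diag: "g x y = b" if "(x, y) \<in> S" for x y
    using assms that unfolding fooling_set_def by blast
  have off: "g x y' = (\<not> b) \<or> g x' y = (\<not> b)"
    if "(x, y) \<in> S" "(x', y') \<in> S" "(x, y) \<noteq> (x', y')" for x y x' y'
    using assms that unfolding fooling_set_def by blast
  show "inj_on fst S"
  proof (rule inj_onI, clarify)
    fix x y x' y' assume S: "(x, y) \<in> S" "(x', y') \<in> S" and eq: "fst (x, y) = fst (x', y')"
    show "x = x' \<and> y = y'" using off[OF S] diag[OF S(1)] diag[OF S(2)] eq by auto
  qed
  show "inj_on snd S"
  proof (rule inj_onI, clarify)
    fix x y x' y' assume S: "(x, y) \<in> S" "(x', y') \<in> S" and eq: "snd (x, y) = snd (x', y')"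
    show "x = x' \<and> y = y'" using off[OF S] diag[OF S(1)] diag[OF S(2)] eq by auto
  qed
qed

lemma fooling_set_subset:
  assumes "fooling_set X Y b g S" "S' \<subseteq> S"
  shows "fooling_set X Y b g S'"
  using assms unfolding fooling_set_def by blast

text \<open>The key \<open>\<kappa> x y\<close> names the random bit behind the cell
  \<open>(x, y)\<close>, and \<open>\<sigma> x y\<close> tells whether the cell shows this bit or
  its negation. The rows in \<open>D y\<close> are the exceptional cells of column \<open>y\<close>,
  about which nothing is assumed. Splitting \<open>S\<close> into halves gives \<open>s * s\<close>
  crossings; at most \<open>2 * s + 2 * s\<close> of them meet an exceptional cell.\<close>

lemma card_fooling_le:
  fixes g :: "'k set \<Rightarrow> 'a \<Rightarrow> 'b \<Rightarrow> bool"
  assumes fin: "finite X" "finite Y" "finite T"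
    and D: "\<And>y. y \<in> Y \<Longrightarrow> finite (D y) \<and> card (D y) \<le> 2"
    and inj: "inj_on (\<lambda>(x, y). \<kappa> x y) {(x, y) \<in> X \<times> Y. x \<notin> D y}"
    and \<kappa>: "\<And>x y. x \<in> X \<Longrightarrow> y \<in> Y \<Longrightarrow> \<kappa> x y \<in> T"
    and g: "\<And>R x y. x \<in> X \<Longrightarrow> y \<in> Y \<Longrightarrow> x \<notin> D y \<Longrightarrow> g R x y = ((\<kappa> x y \<in> R) = \<sigma> x y)"
    and S: "card S = 2 * s"
  shows "real (card {R \<in> Pow T. fooling_set X Y b (g R) S}) \<le> (3/4) ^ (s * (s - 4)) * 2 ^ card T"
\<comment> \<open>A single \<open>R0\<close> suffices to get
  \<open>S \<subseteq> X \<times> Y\<close> and injectivity of both projections, facts that do not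
  mention \<open>R\<close>. Without such an \<open>R0\<close> the count is zero.\<close>
proof (cases "\<exists>R. fooling_set X Y b (g R) S")
  case False
  then show ?thesis by simp
next
  case True
  then obtain R0 where R0: "fooling_set X Y b (g R0) S" by blast
  have SXY: "S \<subseteq> X \<times> Y" using R0 by (simp add: fooling_set_def)
  then have finS: "finite S" using fin finite_subset by blast
  note injS = fooling_set_inj_on[OF R0]
  obtain S1 where S1: "S1 \<subseteq> S" "card S1 = s"
    using S obtain_subset_with_card_n[of s S] by auto
  define S2 where "S2 = S - S1"
  have fin12: "finite S1" "finite S2" using S1 finS by (auto simp: S2_def intro: finite_subset)
  have S2: "S2 \<subseteq> S" "card S2 = s" "S1 \<inter> S2 = {}"
    using S S1 fin12 by (auto simp: S2_def card_Diff_subset)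
  have in_D: "card {a \<in> A. fst a \<in> D (snd b)} \<le> 2" if "A \<subseteq> S" "b \<in> S" for A b
  proof -
    have D': "finite (D (snd b))" "card (D (snd b)) \<le> 2" using D that SXY by fastforce+
    have "card {a \<in> A. fst a \<in> D (snd b)} \<le> card (D (snd b))"
      using D' that inj_on_subset[OF injS(1)]
      by (intro card_inj_on_le[where f = fst]) (auto intro: inj_on_subset)
    then show ?thesis using D' by simp
  qed
  \<comment> \<open>A pair \<open>(a, b)\<close> of \<open>S1 \<times> S2\<close> is discarded when
    one of its two crossed cells is exceptional. \<open>B2\<close> lists its pairs in swapped order,
    so that in both relations the second component supplies the column and
    \<open>card_relation_le\<close> applies.\<close>
  define B1 where "B1 = {(a, b) \<in> S1 \<times> S2. fst a \<in> D (snd b)}"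
  define B2 where "B2 = {(b, a) \<in> S2 \<times> S1. fst b \<in> D (snd a)}"
  define I where "I = {(a, b) \<in> S1 \<times> S2. fst a \<notin> D (snd b) \<and> fst b \<notin> D (snd a)}"
  define p :: "('a \<times> 'b) \<times> 'a \<times> 'b \<Rightarrow> 'k" where "p = (\<lambda>(a, b). \<kappa> (fst a) (snd b))"
  define q :: "('a \<times> 'b) \<times> 'a \<times> 'b \<Rightarrow> 'k" where "q = (\<lambda>(a, b). \<kappa> (fst b) (snd a))"
  \<comment> \<open>The fooling condition fails when both crossed values are \<open>b\<close>.
    Solving \<open>((\<kappa> x y \<in> R) = \<sigma> x y) = b\<close> for the membership gives
    \<open>\<sigma> x y = b\<close>, the pattern to be avoided.\<close>
  define u :: "('a \<times> 'b) \<times> 'a \<times> 'b \<Rightarrow> bool" where "u = (\<lambda>(a, c). \<sigma> (fst a) (snd c) = b)"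
  define v :: "('a \<times> 'b) \<times> 'a \<times> 'b \<Rightarrow> bool" where "v = (\<lambda>(a, c). \<sigma> (fst c) (snd a) = b)"
  have "card B1 \<le> 2 * s" unfolding B1_def
    using fin12 S1 S2 in_D by (intro card_relation_le) auto
  moreover have "card B2 \<le> 2 * s" unfolding B2_def
    using fin12 S1 S2 in_D by (intro card_relation_le) auto
  moreover have "s * s \<le> card I + card B1 + card B2"
  proof -
    have finB: "finite B1" "finite B2" "finite I"
      unfolding B1_def B2_def I_def
      using fin12 by (auto intro: finite_subset[of _ "S1 \<times> S2"] finite_subset[of _ "S2 \<times> S1"])
    have "s * s = card (S1 \<times> S2)" using S1 S2 by (simp add: card_cartesian_product)
    also have "\<dots> \<le> card (I \<union> B1 \<union> prod.swap ` B2)"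
      using finB by (intro card_mono) (auto simp: I_def B1_def B2_def image_iff)
    also have "\<dots> \<le> card I + card B1 + card (prod.swap ` B2)"
      by (meson add_le_mono1 card_Un_le order_trans)
    also have "\<dots> \<le> card I + card B1 + card B2"
      using finB by (simp add: card_image_le)
    finally show ?thesis .
  qed
  ultimately have cardI: "s * (s - 4) \<le> card I"
    by (simp add: diff_mult_distrib2)
  have mem: "fst a \<in> X" "snd a \<in> Y" if "a \<in> S" for a using that SXY by auto
  have inj': "x = x' \<and> y = y'"
    if "x \<in> X" "y \<in> Y" "x \<notin> D y" "x' \<in> X" "y' \<in> Y" "x' \<notin> D y'" "\<kappa> x y = \<kappa> x' y'"
    for x y x' y'
    using inj_onD[OF inj, of "(x, y)" "(x', y')"] that by auto
  \<comment> \<open>Off \<open>D\<close> a key determines row and column; within \<open>S\<close>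
    the row determines the first pair and the column the second.\<close>
  have cells: "a = a' \<and> b = b'"
    if "a \<in> S" "b \<in> S" "fst a \<notin> D (snd b)" "a' \<in> S" "b' \<in> S" "fst a' \<notin> D (snd b')"
      "\<kappa> (fst a) (snd b) = \<kappa> (fst a') (snd b')" for a b a' b'
    using inj'[of "fst a" "snd b" "fst a'" "snd b'"] that mem injS by (auto dest: inj_onD)
  have "card {R \<in> Pow T. fooling_set X Y b (g R) S}
    \<le> card {R \<in> Pow T. \<forall>i\<in>I. \<not> ((p i \<in> R) = u i \<and> (q i \<in> R) = v i)}"
  proof (rule card_mono)
    show "{R \<in> Pow T. fooling_set X Y b (g R) S}
      \<subseteq> {R \<in> Pow T. \<forall>i\<in>I. \<not> ((p i \<in> R) = u i \<and> (q i \<in> R) = v i)}"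
    proof
      fix R assume R: "R \<in> {R \<in> Pow T. fooling_set X Y b (g R) S}"
      have "\<not> ((p i \<in> R) = u i \<and> (q i \<in> R) = v i)" if "i \<in> I" for i
      proof -
        obtain a1 a2 c1 c2 where i: "i = ((a1, a2), (c1, c2))" by (metis surj_pair)
        have in_S: "(a1, a2) \<in> S" "(c1, c2) \<in> S" "(a1, a2) \<noteq> (c1, c2)"
          using that i S1 S2 by (auto simp: I_def)
        then have "g R a1 c2 = (\<not> b) \<or> g R c1 a2 = (\<not> b)"
          using R unfolding fooling_set_def by blast
        moreover have "g R a1 c2 = ((\<kappa> a1 c2 \<in> R) = \<sigma> a1 c2)"
          "g R c1 a2 = ((\<kappa> c1 a2 \<in> R) = \<sigma> c1 a2)"
          by (rule g; use in_S that i SXY in \<open>auto simp: I_def\<close>)+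
        ultimately show ?thesis by (auto simp: i p_def q_def u_def v_def)
      qed
      then show "R \<in> {R \<in> Pow T. \<forall>i\<in>I. \<not> ((p i \<in> R) = u i \<and> (q i \<in> R) = v i)}"
        using R by blast
    qed
  qed (use fin in auto)
  then have "real (card {R \<in> Pow T. fooling_set X Y b (g R) S})
    \<le> real (card {R \<in> Pow T. \<forall>i\<in>I. \<not> ((p i \<in> R) = u i \<and> (q i \<in> R) = v i)})"
    by simp
  also have "\<dots> \<le> (3/4) ^ card I * 2 ^ card T"
  proof (rule card_avoiding_le)
    have IS: "fst i \<in> S" "snd i \<in> S" "fst i \<in> S1" "snd i \<in> S2"
      "fst (fst i) \<notin> D (snd (snd i))" "fst (snd i) \<notin> D (snd (fst i))" if "i \<in> I" for i
      using that S1(1) S2(1) by (auto simp: I_def)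
    have pq: "p i = \<kappa> (fst (fst i)) (snd (snd i))" "q i = \<kappa> (fst (snd i)) (snd (fst i))" for i
      by (simp_all add: p_def q_def case_prod_beta)
    show "finite I" unfolding I_def
      using fin12 by (auto intro: finite_subset[of _ "S1 \<times> S2"])
    show "p ` I \<subseteq> T" "q ` I \<subseteq> T"
      unfolding pq image_subset_iff by (intro ballI \<kappa> mem IS; assumption)+
    show "inj_on p I"
    proof (rule inj_onI)
      fix i j assume "i \<in> I" "j \<in> I" "p i = p j"
      then show "i = j" using cells[of "fst i" "snd i" "fst j" "snd j"] IS
        by (simp add: pq prod_eq_iff[of i j])
    qed
    show "inj_on q I"
    proof (rule inj_onI)
      fix i j assume "i \<in> I" "j \<in> I" "q i = q j"
      then show "i = j" using cells[of "snd i" "fst i" "snd j" "fst j"] IS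
        by (simp add: pq prod_eq_iff[of i j])
    qed
    \<comment> \<open>Keys \<open>p\<close> have their row from \<open>S1\<close>, keys
      \<open>q\<close> from \<open>S2\<close>; a common key would put one pair into both
      halves.\<close>
    have False if "i \<in> I" "j \<in> I" "p i = q j" for i j
      using cells[of "fst i" "snd i" "snd j" "fst j"] IS[OF that(1)] IS[OF that(2)] that(3) S2(3)
      by (auto simp: pq)
    then show "p ` I \<inter> q ` I = {}" by fast
  qed (use fin in auto)
  also have "\<dots> \<le> (3/4) ^ (s * (s - 4)) * 2 ^ card T"
    using cardI by (intro mult_right_mono power_decreasing) auto
  finally show ?thesis .
qed

section \<open>Union bound over all candidates\<close>

text \<open>Every larger fooling set contains one with exactly \<open>2 * s\<close> pairs, so only
  those candidates are summed over. The factor 2 counts the values of \<open>b\<close>.\<close>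

lemma card_ex_fooling_le:
  fixes g :: "'k set \<Rightarrow> 'a \<Rightarrow> 'b \<Rightarrow> bool"
  assumes fin: "finite X" "finite Y" "finite T"
    and D: "\<And>y. y \<in> Y \<Longrightarrow> finite (D y) \<and> card (D y) \<le> 2"
    and inj: "inj_on (\<lambda>(x, y). \<kappa> x y) {(x, y) \<in> X \<times> Y. x \<notin> D y}"
    and \<kappa>: "\<And>x y. x \<in> X \<Longrightarrow> y \<in> Y \<Longrightarrow> \<kappa> x y \<in> T"
    and g: "\<And>R x y. x \<in> X \<Longrightarrow> y \<in> Y \<Longrightarrow> x \<notin> D y \<Longrightarrow> g R x y = ((\<kappa> x y \<in> R) = \<sigma> x y)"
  shows "real (card {R \<in> Pow T. \<exists>b S. fooling_set X Y b (g R) S \<and> card S \<ge> 2 * s})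
    \<le> 2 * real (card X * card Y) ^ (2 * s) * (3/4) ^ (s * (s - 4)) * 2 ^ card T"
proof -
  define C where "C = {S. S \<subseteq> X \<times> Y \<and> card S = 2 * s}"
  define E where "E = (\<lambda>(b, S). {R \<in> Pow T. fooling_set X Y b (g R) S})"
  have finC: "finite C" unfolding C_def using fin by auto
  have cardC: "real (card C) \<le> real (card X * card Y) ^ (2 * s)"
  proof (cases "2 * s \<le> card (X \<times> Y)")
    case True
    have "card C = card (X \<times> Y) choose (2 * s)"
      unfolding C_def using fin by (intro n_subsets) auto
    also have "\<dots> \<le> card (X \<times> Y) ^ (2 * s)" using True by (rule binomial_le_pow)
    finally show ?thesis by (simp only: card_cartesian_product of_nat_le_iff flip: of_nat_power)
  next
    case False
    have "C = {}"
    proof (rule equals0I)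
      fix S assume "S \<in> C"
      then have "S \<subseteq> X \<times> Y" "card S = 2 * s" by (simp_all add: C_def)
      with False card_mono[of "X \<times> Y" S] show False using fin by simp
    qed
    then show ?thesis by simp
  qed
  have "{R \<in> Pow T. \<exists>b S. fooling_set X Y b (g R) S \<and> card S \<ge> 2 * s}
    \<subseteq> (\<Union>bS \<in> UNIV \<times> C. E bS)"
  proof safe
    fix R b S assume F: "fooling_set X Y b (g R) S" "2 * s \<le> card S" and R: "R \<subseteq> T"
    then obtain S' where S': "S' \<subseteq> S" "card S' = 2 * s"
      by (meson obtain_subset_with_card_n)
    then have "fooling_set X Y b (g R) S'" using F fooling_set_subset by blast
    moreover from this have "S' \<in> C" using S' by (simp add: C_def fooling_set_def)
    ultimately show "R \<in> (\<Union>bS \<in> UNIV \<times> C. E bS)" using R by (auto simp: E_def)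
  qed
  then have "card {R \<in> Pow T. \<exists>b S. fooling_set X Y b (g R) S \<and> card S \<ge> 2 * s}
    \<le> card (\<Union>bS \<in> UNIV \<times> C. E bS)"
    using fin finC by (intro card_mono) (auto simp: E_def)
  also have "\<dots> \<le> (\<Sum>bS \<in> UNIV \<times> C. card (E bS))"
    using finC by (intro card_UN_le) auto
  finally have "real (card {R \<in> Pow T. \<exists>b S. fooling_set X Y b (g R) S \<and> card S \<ge> 2 * s})
    \<le> (\<Sum>bS \<in> UNIV \<times> C. real (card (E bS)))" by (simp flip: of_nat_sum)
  also have "\<dots> \<le> (\<Sum>bS \<in> (UNIV :: bool set) \<times> C. (3/4) ^ (s * (s - 4)) * 2 ^ card T)"
  proof (intro sum_mono)
    fix bS :: "bool \<times> ('a \<times> 'b) set" assume "bS \<in> UNIV \<times> C"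
    then have "card (snd bS) = 2 * s" by (auto simp: C_def)
    then show "real (card (E bS)) \<le> (3/4) ^ (s * (s - 4)) * 2 ^ card T"
      unfolding E_def case_prod_beta using fin D inj \<kappa> g
      by (intro card_fooling_le[where D = D and \<kappa> = \<kappa> and \<sigma> = \<sigma>]) auto
  qed
  also have "\<dots> = 2 * real (card C) * ((3/4) ^ (s * (s - 4)) * 2 ^ card T)"
    by (simp add: card_cartesian_product)
  also have "\<dots> \<le> 2 * real (card X * card Y) ^ (2 * s) * ((3/4) ^ (s * (s - 4)) * 2 ^ card T)"
    using cardC by (intro mult_right_mono mult_left_mono) auto
  finally show ?thesis by (simp only: mult.assoc)
qed

section \<open>The random function and its induced functions\<close>

text \<open>\<open>R\<close> is the table of random bits: for \<open>a \<noteq> b\<close> the entry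
  \<open>(a, a, b)\<close> stores the bit \<open>r(a,b)\<close> shared by three argument triples,
  and a triple of distinct strings stores its own bit.\<close>

definition three_arg :: "('a \<times> 'a \<times> 'a) set \<Rightarrow> 'a list \<Rightarrow> bool" where
  "three_arg R xs = (let x = xs ! 0; y = xs ! 1; z = xs ! 2 in
     if x = y \<and> y = z then True
     else if x = y then (x, x, z) \<in> R
     else if x = z then (x, x, y) \<notin> R
     else if y = z then (y, y, x) \<in> R
     else (x, y, z) \<in> R)"

lemma three_arg_diagonal:
  "multi_fooling_set 3 X True (three_arg R) ((\<lambda>x. [x, x, x]) ` X)"
  unfolding multi_fooling_set_def
proof (intro conjI ballI impI)
  show "(\<lambda>x. [x, x, x]) ` X \<subseteq> tuples 3 X" by (auto simp: tuples_def)
  show "three_arg R x = True" if "x \<in> (\<lambda>x. [x, x, x]) ` X" for x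
    using that by (auto simp: three_arg_def)
  fix xs zs assume "xs \<in> (\<lambda>x. [x, x, x]) ` X" "zs \<in> (\<lambda>x. [x, x, x]) ` X" "xs \<noteq> zs"
  then obtain x z where xz: "xs = [x, x, x]" "zs = [z, z, z]" "x \<noteq> z" by auto
  show "\<exists>A B. A \<union> B = {..<3} \<and> A \<inter> B = {} \<and> three_arg R (mix A B xs zs) = (\<not> True)"
  \<comment> \<open>The two partitions below produce \<open>[x, z, x]\<close> and
    \<open>[x, x, z]\<close>, whose values are opposite; the case distinction picks the one with
    value \<open>False\<close>.\<close>
  proof (cases "(x, x, z) \<in> R")
    case True
    then show ?thesis using xz
      by (intro exI[of _ "{0, 2::nat}"] exI[of _ "{1::nat}"])
        (auto simp: mix_def three_arg_def upt_rec numeral_eq_Suc)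
  next
    case False
    then show ?thesis using xz
      by (intro exI[of _ "{0, 1::nat}"] exI[of _ "{2::nat}"])
        (auto simp: mix_def three_arg_def upt_rec numeral_eq_Suc)
  qed
qed

lemma card_three_arg_fooling_le:
  fixes X :: "'a set"
  assumes "finite X" and h: "h \<in> {induced1, induced2, induced3}"
  shows "real (card {R \<in> Pow (X \<times> X \<times> X).
      \<exists>b S. fooling_set X (X \<times> X) b (h (three_arg R)) S \<and> card S \<ge> 2 * s})
    \<le> 2 * real (card X ^ 3) ^ (2 * s) * (3/4) ^ (s * (s - 4)) * 2 ^ card (X \<times> X \<times> X)"
proof -
  let ?D = "\<lambda>(y, z). {y, z :: 'a}"
  have bound: ?thesis
    if "inj_on (\<lambda>(x, y). \<kappa> x y) {(x, y) \<in> X \<times> (X \<times> X). x \<notin> ?D y}"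
      and "\<And>x y. x \<in> X \<Longrightarrow> y \<in> X \<times> X \<Longrightarrow> \<kappa> x y \<in> X \<times> X \<times> X"
      and "\<And>R x y. x \<in> X \<Longrightarrow> y \<in> X \<times> X \<Longrightarrow> x \<notin> ?D y \<Longrightarrow>
        h (three_arg R) x y = ((\<kappa> x y \<in> R) = \<sigma> x y)"
    for \<kappa> :: "'a \<Rightarrow> 'a \<times> 'a \<Rightarrow> 'a \<times> 'a \<times> 'a" and \<sigma>
  proof -
    have D: "finite (?D y) \<and> card (?D y) \<le> 2" for y :: "'a \<times> 'a"
      by (cases y) (simp add: card_insert_if)
    have "card X * card (X \<times> X) = card X ^ 3"
      by (simp add: card_cartesian_product power3_eq_cube)
    then show ?thesis
      using card_ex_fooling_le[of X "X \<times> X" "X \<times> X \<times> X" ?D \<kappa> "\<lambda>R. h (three_arg R)" \<sigma> s] assms(1) that D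
      by simp
  qed
  \<comment> \<open>When the row string is not in the column pair, the only possible coincidence is
    inside that pair. The key then has the repeated string first, as in \<open>three_arg\<close>.
    For \<open>induced2\<close> the row is the middle argument, so this coincidence yields the
    negated bit; for \<open>induced3\<close> the triple already has the form of the key.\<close>
  from h consider "h = induced1" | "h = induced2" | "h = induced3" by blast
  then show ?thesis
  proof cases
    case 1
    show ?thesis
      by (rule bound[of "\<lambda>x (y, z). if y = z then (y, y, x) else (x, y, z)" "\<lambda>_ _. True"])
        (auto simp: 1 induced1_def three_arg_def inj_on_def split: if_splits)
  next
    case 2
    show ?thesis
      by (rule bound[of "\<lambda>y (x, z). if x = z then (x, x, y) else (x, y, z)" "\<lambda>_ (x, z). x \<noteq> z"])
        (auto simp: 2 induced2_def three_arg_def inj_on_def split: if_splits)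
  next
    case 3
    show ?thesis
      by (rule bound[of "\<lambda>z (x, y). (x, y, z)" "\<lambda>_ _. True"])
        (auto simp: 3 induced3_def three_arg_def inj_on_def)
  qed
qed

section \<open>Numerical estimate and choice of the function\<close>

text \<open>The factor 6 counts three induced functions times two values of \<open>b\<close>. The
  candidates contribute \<open>2 ^ (144 * n\<^sup>2)\<close>, while \<open>s * (s - 4)\<close> is
  about \<open>576 * n\<^sup>2\<close> and every three factors \<open>3/4\<close> give
  \<open>27/64\<close>, less than \<open>1/2\<close>.\<close>

lemma union_bound_lt_1:
  assumes "n \<ge> 1" "s = 24 * n"
  shows "6 * real ((2 ^ n) ^ 3) ^ (2 * s) * (3/4) ^ (s * (s - 4)) < 1"
proof -
  define k where "k = 192 * n\<^sup>2 - 32 * n"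
  have n2: "n \<le> n\<^sup>2" using assms by (simp add: power2_eq_square)
  have k: "s * (s - 4) = 3 * k"
    by (simp add: k_def assms diff_mult_distrib2 power2_eq_square)
  \<comment> \<open>Indeed \<open>k\<close> is at least \<open>160 * n\<^sup>2\<close>. The surplus
    3 provides the factor \<open>1/8\<close> that beats 6.\<close>
  have lt: "144 * n\<^sup>2 + 3 \<le> k" using n2 assms by (simp add: k_def)
  have "real ((2 ^ n) ^ 3) ^ (2 * s) = 2 ^ (n * 3 * (2 * s))"
    by (simp only: of_nat_power of_nat_numeral power_mult)
  also have "n * 3 * (2 * s) = 144 * n\<^sup>2" by (simp add: assms power2_eq_square)
  finally have A: "real ((2 ^ n) ^ 3) ^ (2 * s) = 2 ^ (144 * n\<^sup>2)" .
  have "((3::real)/4) ^ (s * (s - 4)) = (27/64) ^ k"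
    unfolding k power_mult by (simp add: power_divide)
  also have "\<dots> \<le> (1/2) ^ k" by (intro power_mono) auto
  also have "\<dots> \<le> (1/2) ^ (144 * n\<^sup>2 + 3)" using lt by (intro power_decreasing) auto
  also have "\<dots> = 1 / (8 * 2 ^ (144 * n\<^sup>2))" by (simp add: power_add power_divide)
  finally have "6 * real ((2 ^ n) ^ 3) ^ (2 * s) * (3/4) ^ (s * (s - 4))
    \<le> 6 * 2 ^ (144 * n\<^sup>2) * (1 / (8 * 2 ^ (144 * n\<^sup>2)))"
    unfolding A by (intro mult_left_mono) auto
  also have "\<dots> < 1" by simp
  finally show ?thesis .
qed

text \<open>The tables that are bad for some induced function are fewer than all subsets of
  \<open>?T\<close>, so one table is good for all three at once.\<close>

lemma ex_three_arg_no_large_fooling: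
  assumes "n \<ge> 1"
  obtains R where "\<And>h b S. h \<in> {induced1, induced2, induced3} \<Longrightarrow>
    fooling_set (bitstrings n) (bitstrings n \<times> bitstrings n) b (h (three_arg R)) S \<Longrightarrow>
    card S < 48 * n"
proof -
  let ?X = "bitstrings n"
  let ?T = "?X \<times> ?X \<times> ?X"
  let ?bad = "\<lambda>h. {R \<in> Pow ?T. \<exists>b S.
    fooling_set ?X (?X \<times> ?X) b (h (three_arg R)) S \<and> card S \<ge> 2 * (24 * n)}"
  have X: "finite ?X" "card ?X = 2 ^ n"
    using finite_lists_length_eq[of "UNIV :: bool set" n] card_lists_length_eq[of "UNIV :: bool set" n]
    by (simp_all add: bitstrings_def)
  define \<epsilon> where "\<epsilon> = 2 * real ((2 ^ n) ^ 3) ^ (2 * (24 * n)) * (3/4) ^ (24 * n * (24 * n - 4))"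
  have "real (card (?bad h)) \<le> \<epsilon> * 2 ^ card ?T" if "h \<in> {induced1, induced2, induced3}" for h
    using card_three_arg_fooling_le[OF X(1) that, of "24 * n"] unfolding X(2) \<epsilon>_def .
  then have b: "real (card (?bad induced1)) \<le> \<epsilon> * 2 ^ card ?T"
    "real (card (?bad induced2)) \<le> \<epsilon> * 2 ^ card ?T"
    "real (card (?bad induced3)) \<le> \<epsilon> * 2 ^ card ?T" by blast+
  have "card (?bad induced1 \<union> ?bad induced2 \<union> ?bad induced3)
    \<le> card (?bad induced1) + card (?bad induced2) + card (?bad induced3)"
    by (meson add_le_mono1 card_Un_le order_trans)
  then have "real (card (?bad induced1 \<union> ?bad induced2 \<union> ?bad induced3)) \<le> (3 * \<epsilon>) * 2 ^ card ?T"
    using b by linarith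
  also have "\<dots> < 1 * 2 ^ card ?T"
    using union_bound_lt_1[OF assms refl] by (intro mult_strict_right_mono) (simp_all add: \<epsilon>_def)
  finally have "real (card (?bad induced1 \<union> ?bad induced2 \<union> ?bad induced3)) < real (card (Pow ?T))"
    using X by (simp add: card_Pow)
  then have "?bad induced1 \<union> ?bad induced2 \<union> ?bad induced3 \<noteq> Pow ?T" by auto
  then obtain R where "R \<in> Pow ?T" "R \<notin> ?bad induced1" "R \<notin> ?bad induced2" "R \<notin> ?bad induced3"
    by blast
  then show ?thesis by (intro that[of R]) (auto simp: not_le[symmetric])
qed

theorem theorem8:
  "\<exists>c::real. c > 0 \<and>
     (\<exists>N::nat. \<forall>n\<ge>N. \<exists>f :: bool list list \<Rightarrow> bool.
        (\<exists>F. multi_fooling_set 3 (bitstrings n) True f F \<and> card F = 2 ^ n) \<and>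
        (\<forall>g \<in> {induced1 f, induced2 f, induced3 f}. \<forall>b S.
           fooling_set (bitstrings n) (bitstrings n \<times> bitstrings n) b g S \<longrightarrow>
           real (card S) \<le> c * real n))"
proof (rule exI[of _ "48::real"], rule conjI, simp, rule exI[of _ "1::nat"], intro allI impI)
  \<comment> \<open>Starting at 1 matters: for \<open>n = 0\<close> the bound is 0, yet a single
    pair is a fooling set. The constant 48 is \<open>2 * s / n\<close> for
    \<open>s = 24 * n\<close>.\<close>
  fix n :: nat assume "1 \<le> n"
  then obtain R where R: "\<And>h b S. h \<in> {induced1, induced2, induced3} \<Longrightarrow>
    fooling_set (bitstrings n) (bitstrings n \<times> bitstrings n) b (h (three_arg R)) S \<Longrightarrow>
    card S < 48 * n" using ex_three_arg_no_large_fooling by blast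
  have le: "real (card S) \<le> 48 * real n" if "h \<in> {induced1, induced2, induced3}"
    "fooling_set (bitstrings n) (bitstrings n \<times> bitstrings n) b (h (three_arg R)) S" for h b S
    using R[OF that] by linarith
  have "card ((\<lambda>x. [x, x, x]) ` bitstrings n) = 2 ^ n"
    using card_lists_length_eq[of "UNIV :: bool set" n]
    by (subst card_image) (auto simp: bitstrings_def inj_on_def)
  then show "\<exists>f :: bool list list \<Rightarrow> bool.
        (\<exists>F. multi_fooling_set 3 (bitstrings n) True f F \<and> card F = 2 ^ n) \<and>
        (\<forall>g \<in> {induced1 f, induced2 f, induced3 f}. \<forall>b S.
           fooling_set (bitstrings n) (bitstrings n \<times> bitstrings n) b g S \<longrightarrow>
           real (card S) \<le> 48 * real n)"
    using three_arg_diagonal le by (intro exI[of _ "three_arg R"]) blast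
qed

end
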